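(* Let $\mathcal{A}$ and $\mathcal{U}$ be Banach algebras such that $\mathcal{U}$ is a Banach $\mathcal{A}$-bimodule with compatible actions and norm, let $\mathcal{A}\ltimes\mathcal{U}$ be their semidirect product, and let $D:\mathcal{A}\ltimes\mathcal{U}\to\mathcal{A}\ltimes\mathcal{U}$ be a map. The following conditions are equivalent. (i) $D$ is a derivation. (ii) $D((a,x))=(\delta_1(a)+\tau_1(x),\,\delta_2(a)+\tau_2(x))$ for all $a\in\mathcal{A}$, $x\in\mathcal{U}$, where (a) $\delta_1:\mathcal{A}\to\mathcal{A}$ is a derivation; (b) $\delta_2:\mathcal{A}\to\mathcal{U}$ is a derivation; (c) $\tau_1:\mathcal{U}\to\mathcal{A}$ is an $\mathcal{A}$-bimodule homomorphism such that $\tau_1(xy)=0$ for all $x,y\in\mathcal{U}$; (d) $\tau_2:\mathcal{U}\to\mathcal{U}$ is a linear map such that for all $a\in\mathcal{A}$ and $x,y\in\mathcal{U}$: $$\tau_2(ax)=a\tau_2(x)+\delta_1(a)x+\delta_2(a)x,$$ $$\tau_2(xa)=\tau_2(x)a+x\delta_1(a)+x\delta_2(a),$$ $$\tau_2(xy)=x\tau_1(y)+\tau_1(x)y+x\tau_2(y)+\tau_2(x)y.$$ Moreover, a derivation $D$ (written as in (ii)) is inner if and only if $\tau_1=0$ and there exist $a_0\in\mathcal{A}$ and $x_0\in\mathcal{U}$ such that $\delta_1=id_{a_0}$, $\delta_2=id_{\mathcal{A},x_0}$ and $\tau_2=id_{\mathcal{U},x_0}+r_{a_0}$.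
   Context: All algebras are over $\mathbb{C}$. "Banach $\mathcal{A}$-bimodule with compatible actions and norm" means: $\|ax\|\le\|a\|\|x\|$, $\|xa\|\le\|x\|\|a\|$, and $a(xy)=(ax)y$, $(xy)a=x(ya)$, $(xa)y=x(ay)$ for all $a\in\mathcal{A}$, $x,y\in\mathcal{U}$. The semidirect product $\mathcal{A}\ltimes\mathcal{U}$ is $\mathcal{A}\times\mathcal{U}$ with multiplication $(a,x)(b,y)=(ab,\,ay+xb+xy)$ and norm $\|(a,x)\|=\|a\|+\|x\|$; it is a Banach algebra. A derivation from an algebra $\mathcal{B}$ into a $\mathcal{B}$-bimodule is a linear map $\delta$ (not assumed continuous) with $\delta(bc)=b\delta(c)+\delta(b)c$; a derivation on $\mathcal{B}$ is one from $\mathcal{B}$ to itself. A derivation on an algebra $\mathcal{B}$ is inner if it equals $b\mapsto bb_0-b_0b$ for some $b_0\in\mathcal{B}$. An $\mathcal{A}$-bimodule homomorphism is a linear map $\phi$ with $\phi(ax)=a\phi(x)$ and $\phi(xa)=\phi(x)a$. Notation: $id_{a_0}:\mathcal{A}\to\mathcal{A}$, $id_{a_0}(a)=aa_0-a_0a$; $id_{\mathcal{A},x_0}:\mathcal{A}\to\mathcal{U}$, $id_{\mathcal{A},x_0}(a)=ax_0-x_0a$; $id_{\mathcal{U},x_0}:\mathcal{U}\to\mathcal{U}$, $id_{\mathcal{U},x_0}(x)=xx_0-x_0x$; $r_{a_0}:\mathcal{U}\to\mathcal{U}$, $r_{a_0}(x)=xa_0-a_0x$. *)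

theory Defs
  imports "HOL-Analysis.Analysis"
begin

section \<open>Complex Banach algebras\<close>

text \<open>
  Algebras are not assumed to have a unit; the library class
  \<^class>\<open>real_normed_algebra\<close> is likewise non-unital and has a submultiplicative norm.
\<close>

class complex_vector = real_vector +
  fixes scaleC :: "complex \<Rightarrow> 'a \<Rightarrow> 'a"  (infixr "*\<^sub>C" 75)
  assumes scaleC_add_right: "c *\<^sub>C (x + y) = c *\<^sub>C x + c *\<^sub>C y"
    and scaleC_add_left: "(c + d) *\<^sub>C x = c *\<^sub>C x + d *\<^sub>C x"
    and scaleC_scaleC: "c *\<^sub>C d *\<^sub>C x = (c * d) *\<^sub>C x"
    and scaleC_one: "1 *\<^sub>C x = x"
    and scaleR_scaleC: "r *\<^sub>R x = complex_of_real r *\<^sub>C x"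

class complex_normed_algebra = complex_vector + real_normed_algebra +
  assumes norm_scaleC: "norm (c *\<^sub>C x) = cmod c * norm x"
    and mult_scaleC_left: "(c *\<^sub>C x) * y = c *\<^sub>C (x * y)"
    and mult_scaleC_right: "x * (c *\<^sub>C y) = c *\<^sub>C (x * y)"

class complex_banach_algebra = complex_normed_algebra + complete_space

interpretation complex_vector: vector_space "scaleC :: complex \<Rightarrow> 'a \<Rightarrow> 'a::complex_vector"
  by unfold_locales
    (simp_all add: scaleC_add_right scaleC_add_left scaleC_scaleC scaleC_one)

abbreviation clinear :: "('a::complex_vector \<Rightarrow> 'b::complex_vector) \<Rightarrow> bool"
  where "clinear \<equiv> Vector_Spaces.linear scaleC scaleC"

lemma clinear_iff:
  "clinear f \<longleftrightarrow> (\<forall>x y. f (x + y) = f x + f y) \<and> (\<forall>c x. f (c *\<^sub>C x) = c *\<^sub>C f x)"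
  by (simp add: Vector_Spaces.linear_iff complex_vector.vector_space_axioms)

instantiation complex :: complex_banach_algebra
begin

definition scaleC_complex :: "complex \<Rightarrow> complex \<Rightarrow> complex"
  where "scaleC_complex c x = c * x"

instance
  by standard (auto simp: scaleC_complex_def algebra_simps norm_mult scaleR_conv_of_real)

end

instantiation prod :: (complex_vector, complex_vector) complex_vector
begin

definition scaleC_prod :: "complex \<Rightarrow> 'a \<times> 'b \<Rightarrow> 'a \<times> 'b"
  where "scaleC_prod c p = (c *\<^sub>C fst p, c *\<^sub>C snd p)"

instance
  by standard
    (auto simp: scaleC_prod_def scaleC_add_right scaleC_add_left scaleC_scaleC scaleC_one
      scaleR_prod_def scaleR_scaleC prod_eq_iff)

end


section \<open>Derivations and bimodule homomorphisms\<close>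

text \<open>
  The multiplication of the semidirect product depends on the module actions, so it cannot be a
  type class instance. Multiplications and actions are therefore explicit arguments. An algebra is
  a bimodule over itself with its multiplication as both actions.
\<close>

definition derivation ::
    "('b::complex_vector \<Rightarrow> 'b \<Rightarrow> 'b) \<Rightarrow> ('b \<Rightarrow> 'm::complex_vector \<Rightarrow> 'm) \<Rightarrow> ('m \<Rightarrow> 'b \<Rightarrow> 'm)
      \<Rightarrow> ('b \<Rightarrow> 'm) \<Rightarrow> bool"
  where "derivation mul lact ract \<delta> \<longleftrightarrow>
    clinear \<delta> \<and> (\<forall>b c. \<delta> (mul b c) = lact b (\<delta> c) + ract (\<delta> b) c)"

abbreviation derivation_on ::
    "('b::complex_vector \<Rightarrow> 'b \<Rightarrow> 'b) \<Rightarrow> ('b \<Rightarrow> 'b) \<Rightarrow> bool"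
  where "derivation_on mul \<equiv> derivation mul mul mul"

definition inner_on :: "('b::complex_vector \<Rightarrow> 'b \<Rightarrow> 'b) \<Rightarrow> ('b \<Rightarrow> 'b) \<Rightarrow> bool"
  where "inner_on mul \<delta> \<longleftrightarrow> (\<exists>b\<^sub>0. \<forall>b. \<delta> b = mul b b\<^sub>0 - mul b\<^sub>0 b)"

definition bimodule_hom ::
    "('a \<Rightarrow> 'x::complex_vector \<Rightarrow> 'x) \<Rightarrow> ('x \<Rightarrow> 'a \<Rightarrow> 'x)
      \<Rightarrow> ('a \<Rightarrow> 'y::complex_vector \<Rightarrow> 'y) \<Rightarrow> ('y \<Rightarrow> 'a \<Rightarrow> 'y) \<Rightarrow> ('x \<Rightarrow> 'y) \<Rightarrow> bool"
  where "bimodule_hom lX rX lY rY \<phi> \<longleftrightarrow>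
    clinear \<phi> \<and> (\<forall>a x. \<phi> (lX a x) = lY a (\<phi> x)) \<and> (\<forall>a x. \<phi> (rX x a) = rY (\<phi> x) a)"


section \<open>Semidirect products\<close>

locale compatible_banach_bimodule =
  fixes lact :: "'a::complex_banach_algebra \<Rightarrow> 'u::complex_banach_algebra \<Rightarrow> 'u"  (infixl "\<rhd>" 70)
    and ract :: "'u \<Rightarrow> 'a \<Rightarrow> 'u"  (infixl "\<lhd>" 70)
  assumes clinear_lact_left: "clinear (\<lambda>a. a \<rhd> x)"
    and clinear_lact_right: "clinear (\<lambda>x. a \<rhd> x)"
    and clinear_ract_left: "clinear (\<lambda>x. x \<lhd> a)"
    and clinear_ract_right: "clinear (\<lambda>a. x \<lhd> a)"
    and lact_lact: "(a * b) \<rhd> x = a \<rhd> (b \<rhd> x)"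
    and ract_ract: "x \<lhd> (a * b) = (x \<lhd> a) \<lhd> b"
    and lact_ract: "(a \<rhd> x) \<lhd> b = a \<rhd> (x \<lhd> b)"
    and norm_lact: "norm (a \<rhd> x) \<le> norm a * norm x"
    and norm_ract: "norm (x \<lhd> a) \<le> norm x * norm a"
    and lact_mult: "a \<rhd> (x * y) = (a \<rhd> x) * y"
    and mult_ract: "(x * y) \<lhd> a = x * (y \<lhd> a)"
    and ract_mult: "(x \<lhd> a) * y = x * (a \<rhd> y)"

definition semidirect_mult ::
    "('a::complex_banach_algebra \<Rightarrow> 'u::complex_banach_algebra \<Rightarrow> 'u) \<Rightarrow> ('u \<Rightarrow> 'a \<Rightarrow> 'u)
      \<Rightarrow> 'a \<times> 'u \<Rightarrow> 'a \<times> 'u \<Rightarrow> 'a \<times> 'u"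
  where "semidirect_mult lact ract = (\<lambda>(a, x) (b, y). (a * b, lact a y + ract x b + x * y))"

text \<open>
  The norm of the semidirect product. It is not the library norm on pairs, which is Euclidean.
  Derivations are not assumed continuous, so no definition below refers to it; the lemmas that
  follow show that it makes the semidirect product a Banach algebra.
\<close>

definition semidirect_norm :: "'a::complex_banach_algebra \<times> 'u::complex_banach_algebra \<Rightarrow> real"
  where "semidirect_norm p = norm (fst p) + norm (snd p)"

lemma semidirect_norm_eq_0_iff: "semidirect_norm p = 0 \<longleftrightarrow> p = 0"
  by (auto simp: semidirect_norm_def prod_eq_iff add_nonneg_eq_0_iff)

lemma semidirect_norm_triangle: "semidirect_norm (p + q) \<le> semidirect_norm p + semidirect_norm q"
  using norm_triangle_ineq[of "fst p" "fst q"] norm_triangle_ineq[of "snd p" "snd q"]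
  by (simp add: semidirect_norm_def)

lemma semidirect_norm_scaleC: "semidirect_norm (c *\<^sub>C p) = cmod c * semidirect_norm p"
  by (simp add: semidirect_norm_def scaleC_prod_def norm_scaleC distrib_left)

lemma semidirect_norm_complete:
  assumes "\<And>e. e > 0 \<Longrightarrow> \<exists>N. \<forall>m\<ge>N. \<forall>n\<ge>N. semidirect_norm (X m - X n) < e"
  shows "\<exists>l. (\<lambda>n. semidirect_norm (X n - l)) \<longlonglongrightarrow> 0"
proof -
  have "Cauchy (\<lambda>n. fst (X n))" "Cauchy (\<lambda>n. snd (X n))"
  proof -
    have *: "norm (fst p) \<le> semidirect_norm p" "norm (snd p) \<le> semidirect_norm p"
      for p :: "'a \<times> 'b"
      by (auto simp: semidirect_norm_def)
    show "Cauchy (\<lambda>n. fst (X n))"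
      unfolding Cauchy_def dist_norm fst_diff[symmetric] using assms *(1) le_less_trans by meson
    show "Cauchy (\<lambda>n. snd (X n))"
      unfolding Cauchy_def dist_norm snd_diff[symmetric] using assms *(2) le_less_trans by meson
  qed
  then obtain a x where "(\<lambda>n. fst (X n)) \<longlonglongrightarrow> a" "(\<lambda>n. snd (X n)) \<longlonglongrightarrow> x"
    by (meson Cauchy_convergent convergentD)
  then have "(\<lambda>n. norm (fst (X n) - a) + norm (snd (X n) - x)) \<longlonglongrightarrow> 0"
    by (auto intro!: tendsto_add_zero tendsto_norm_zero LIM_zero)
  then show ?thesis
    by (intro exI[of _ "(a, x)"]) (simp add: semidirect_norm_def)
qed

context compatible_banach_bimodule
begin

lemma semidirect_mult_assoc:
  "semidirect_mult (\<rhd>) (\<lhd>) (semidirect_mult (\<rhd>) (\<lhd>) p q) r =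
    semidirect_mult (\<rhd>) (\<lhd>) p (semidirect_mult (\<rhd>) (\<lhd>) q r)"
  using clinear_lact_right clinear_ract_left
  by (auto simp: semidirect_mult_def clinear_iff split_beta algebra_simps
      lact_lact ract_ract lact_ract lact_mult mult_ract ract_mult)

lemma clinear_semidirect_mult_left: "clinear (\<lambda>p. semidirect_mult (\<rhd>) (\<lhd>) p q)"
  using clinear_lact_left clinear_ract_left
  by (auto simp: semidirect_mult_def clinear_iff split_beta algebra_simps scaleC_prod_def
      mult_scaleC_left scaleC_add_right)

lemma clinear_semidirect_mult_right: "clinear (\<lambda>q. semidirect_mult (\<rhd>) (\<lhd>) p q)"
  using clinear_lact_right clinear_ract_right
  by (auto simp: semidirect_mult_def clinear_iff split_beta algebra_simps scaleC_prod_def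
      mult_scaleC_right scaleC_add_right)

lemma semidirect_norm_mult:
  "semidirect_norm (semidirect_mult (\<rhd>) (\<lhd>) p q) \<le> semidirect_norm p * semidirect_norm q"
proof -
  obtain a x b y where pq: "p = (a, x)" "q = (b, y)"
    by (meson surj_pair)
  have "norm (a \<rhd> y + x \<lhd> b + x * y) \<le> norm a * norm y + norm x * norm b + norm x * norm y"
    by (intro norm_triangle_le add_mono norm_lact norm_ract norm_mult_ineq)
  moreover have "norm (a * b) \<le> norm a * norm b"
    by (rule norm_mult_ineq)
  ultimately show ?thesis
    by (simp add: pq semidirect_mult_def semidirect_norm_def algebra_simps)
qed

end

text \<open>
  Without linearity the four maps would be determined by \<^term>\<open>D\<close> only up to constants;
  as linear maps they are unique.
\<close>

definition derivation_components ::
    "('a::complex_banach_algebra \<Rightarrow> 'u::complex_banach_algebra \<Rightarrow> 'u) \<Rightarrow> ('u \<Rightarrow> 'a \<Rightarrow> 'u)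
      \<Rightarrow> ('a \<times> 'u \<Rightarrow> 'a \<times> 'u)
      \<Rightarrow> ('a \<Rightarrow> 'a) \<Rightarrow> ('a \<Rightarrow> 'u) \<Rightarrow> ('u \<Rightarrow> 'a) \<Rightarrow> ('u \<Rightarrow> 'u) \<Rightarrow> bool"
  where "derivation_components lact ract D \<delta>\<^sub>1 \<delta>\<^sub>2 \<tau>\<^sub>1 \<tau>\<^sub>2 \<longleftrightarrow>
    (\<forall>a x. D (a, x) = (\<delta>\<^sub>1 a + \<tau>\<^sub>1 x, \<delta>\<^sub>2 a + \<tau>\<^sub>2 x)) \<and>
    derivation_on (*) \<delta>\<^sub>1 \<and>
    derivation (*) lact ract \<delta>\<^sub>2 \<and>
    bimodule_hom lact ract (*) (*) \<tau>\<^sub>1 \<and> (\<forall>x y. \<tau>\<^sub>1 (x * y) = 0) \<and>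
    clinear \<tau>\<^sub>2 \<and>
    (\<forall>a x. \<tau>\<^sub>2 (lact a x) = lact a (\<tau>\<^sub>2 x) + lact (\<delta>\<^sub>1 a) x + \<delta>\<^sub>2 a * x) \<and>
    (\<forall>a x. \<tau>\<^sub>2 (ract x a) = ract (\<tau>\<^sub>2 x) a + ract x (\<delta>\<^sub>1 a) + x * \<delta>\<^sub>2 a) \<and>
    (\<forall>x y. \<tau>\<^sub>2 (x * y) = ract x (\<tau>\<^sub>1 y) + lact (\<tau>\<^sub>1 x) y + x * \<tau>\<^sub>2 y + \<tau>\<^sub>2 x * y)"

end

theory Submission
  imports Defs
begin

text \<open>
  A linear map \<^term>\<open>D\<close> on the product space is a two by two matrix of linear maps, with
  entries \<open>\<delta>\<^sub>1\<close>, \<open>\<tau>\<^sub>1\<close> in the first row and \<open>\<delta>\<^sub>2\<close>, \<open>\<tau>\<^sub>2\<close> in the second. Both sides of the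
  Leibniz identity for \<^term>\<open>D\<close> are additive in each of the two factors, and every element is
  the sum of one from each summand, so the identity needs to be tested only when each factor
  lies in one of the summands. This leaves four cases, each an identity in the first and in
  the second coordinate, and these eight identities are the conditions on the entries: the
  factors \<open>(a, 0)\<close> and \<open>(b, 0)\<close> say that \<open>\<delta>\<^sub>1\<close> and \<open>\<delta>\<^sub>2\<close> are derivations; the mixed products
  say that \<open>\<tau>\<^sub>1\<close> respects the actions and give the first two rules for \<open>\<tau>\<^sub>2\<close>; the factors
  \<open>(0, x)\<close> and \<open>(0, y)\<close> give the vanishing of \<open>\<tau>\<^sub>1\<close> on products and the last rule for \<open>\<tau>\<^sub>2\<close>.
  The reduction is \<open>leibniz_from_summands\<close>, and the four products are
  \<open>semidirect_mult_summands\<close>.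

  For innerness, the commutator with \<open>(a\<^sub>0, x\<^sub>0)\<close> is computed once. Its first coordinate does not
  depend on the second component of the argument, which forces \<open>\<tau>\<^sub>1 = 0\<close>, and the remaining
  entries are read off by restricting to the two summands (\<open>inner_iff_components_inner\<close>).
\<close>

lemma clinear_add: "clinear f \<Longrightarrow> f (x + y) = f x + f y"
  by (simp add: clinear_iff)

lemma clinear_0: "clinear f \<Longrightarrow> f 0 = 0"
  using clinear_add[of f 0 0] by simp

lemma clinear_prod_entries:
  fixes D :: "'a::complex_vector \<times> 'b::complex_vector \<Rightarrow> 'c::complex_vector \<times> 'd::complex_vector"
  assumes "clinear D"
  shows "clinear (\<lambda>a. fst (D (a, 0)))" "clinear (\<lambda>a. snd (D (a, 0)))"
    "clinear (\<lambda>x. fst (D (0, x)))" "clinear (\<lambda>x. snd (D (0, x)))"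
proof -
  have add: "D (p + q) = D p + D q" and scale: "D (c *\<^sub>C p) = c *\<^sub>C D p" for p q c
    using assms by (simp_all only: clinear_iff)
  have "D (a + b, 0) = D (a, 0) + D (b, 0)" "D (0, x + y) = D (0, x) + D (0, y)" for a b x y
    using add[of "(a, 0)" "(b, 0)"] add[of "(0, x)" "(0, y)"] by simp_all
  moreover have "D (c *\<^sub>C a, 0) = c *\<^sub>C D (a, 0)" "D (0, c *\<^sub>C x) = c *\<^sub>C D (0, x)" for c a x
    using scale[of c "(a, 0)"] scale[of c "(0, x)"] by (simp_all add: scaleC_prod_def)
  ultimately show "clinear (\<lambda>a. fst (D (a, 0)))" "clinear (\<lambda>a. snd (D (a, 0)))"
    "clinear (\<lambda>x. fst (D (0, x)))" "clinear (\<lambda>x. snd (D (0, x)))"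
    by (simp_all add: clinear_iff scaleC_prod_def)
qed

lemma clinear_prod_of_entries:
  assumes "clinear \<delta>\<^sub>1" "clinear \<delta>\<^sub>2" "clinear \<tau>\<^sub>1" "clinear \<tau>\<^sub>2"
    and "\<And>a x. D (a, x) = (\<delta>\<^sub>1 a + \<tau>\<^sub>1 x, \<delta>\<^sub>2 a + \<tau>\<^sub>2 x)"
  shows "clinear D"
  using assms by (auto simp: clinear_iff scaleC_prod_def scaleC_add_right)

context compatible_banach_bimodule
begin

abbreviation smult :: "'a \<times> 'u \<Rightarrow> 'a \<times> 'u \<Rightarrow> 'a \<times> 'u"  (infixl "\<odot>" 70)
  where "p \<odot> q \<equiv> semidirect_mult (\<rhd>) (\<lhd>) p q"

lemma action_zero [simp]: "0 \<rhd> x = 0" "a \<rhd> 0 = 0" "0 \<lhd> a = 0" "x \<lhd> 0 = 0"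
  using clinear_0[OF clinear_lact_left, of x] clinear_0[OF clinear_lact_right, of a]
    clinear_0[OF clinear_ract_left, of a] clinear_0[OF clinear_ract_right, of x]
  by simp_all

lemma semidirect_mult_summands:
  "(a, 0) \<odot> (b, y) = (a * b, a \<rhd> y)" "(a, x) \<odot> (b, 0) = (a * b, x \<lhd> b)"
  "(0, x) \<odot> (b, y) = (0, x \<lhd> b + x * y)" "(a, x) \<odot> (0, y) = (0, a \<rhd> y + x * y)"
  by (simp_all add: semidirect_mult_def)

text \<open>
  The discrepancy between the two sides of the Leibniz identity is additive in each factor, so
  it vanishes as soon as it vanishes on the two summands.
\<close>

lemma leibniz_from_summands:
  assumes "clinear D"
    and "\<And>a b. D ((a, 0) \<odot> (b, 0)) = (a, 0) \<odot> D (b, 0) + D (a, 0) \<odot> (b, 0)"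
    and "\<And>a y. D ((a, 0) \<odot> (0, y)) = (a, 0) \<odot> D (0, y) + D (a, 0) \<odot> (0, y)"
    and "\<And>x b. D ((0, x) \<odot> (b, 0)) = (0, x) \<odot> D (b, 0) + D (0, x) \<odot> (b, 0)"
    and "\<And>x y. D ((0, x) \<odot> (0, y)) = (0, x) \<odot> D (0, y) + D (0, x) \<odot> (0, y)"
  shows "D (p \<odot> q) = p \<odot> D q + D p \<odot> q"
proof -
  have biadd: "(p + q) \<odot> r = p \<odot> r + q \<odot> r" "r \<odot> (p + q) = r \<odot> p + r \<odot> q" for p q r
    by (rule clinear_add[OF clinear_semidirect_mult_left],
        rule clinear_add[OF clinear_semidirect_mult_right])
  obtain a x b y where "p = (a, 0) + (0, x)" "q = (b, 0) + (0, y)"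
    by (cases p, cases q) simp
  then show ?thesis
    by (simp only: biadd clinear_add[OF \<open>clinear D\<close>] assms(2-) ac_simps)
qed

lemma derivation_components_imp_derivation:
  assumes "derivation_components (\<rhd>) (\<lhd>) D \<delta>\<^sub>1 \<delta>\<^sub>2 \<tau>\<^sub>1 \<tau>\<^sub>2"
  shows "derivation_on (\<odot>) D"
proof -
  note comps = assms[unfolded derivation_components_def derivation_def bimodule_hom_def]
  have lin: "clinear \<delta>\<^sub>1" "clinear \<delta>\<^sub>2" "clinear \<tau>\<^sub>1" "clinear \<tau>\<^sub>2"
    using comps by blast+
  have "clinear D"
    using clinear_prod_of_entries[OF lin] comps by blast
  moreover have "D (p \<odot> q) = p \<odot> D q + D p \<odot> q" for p q
    using \<open>clinear D\<close>
    by (rule leibniz_from_summands)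
      (simp_all add: comps lin[THEN clinear_0] semidirect_mult_summands algebra_simps)
  ultimately show ?thesis
    by (simp add: derivation_def)
qed

text \<open>
  Conversely the entries of \<^term>\<open>D\<close> inherit their identities from the Leibniz rule on the
  four kinds of products of elements of the summands.
\<close>

lemma derivation_imp_derivation_components:
  assumes "derivation_on (\<odot>) D"
  shows "derivation_components (\<rhd>) (\<lhd>) D
    (\<lambda>a. fst (D (a, 0))) (\<lambda>a. snd (D (a, 0))) (\<lambda>x. fst (D (0, x))) (\<lambda>x. snd (D (0, x)))"
proof -
  have "clinear D" and leibniz: "\<And>p q. D (p \<odot> q) = p \<odot> D q + D p \<odot> q"
    using assms by (auto simp: derivation_def)
  define \<delta>\<^sub>1 \<delta>\<^sub>2 \<tau>\<^sub>1 \<tau>\<^sub>2 where entries: "\<delta>\<^sub>1 = (\<lambda>a. fst (D (a, 0)))" "\<delta>\<^sub>2 = (\<lambda>a. snd (D (a, 0)))"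
    "\<tau>\<^sub>1 = (\<lambda>x. fst (D (0, x)))" "\<tau>\<^sub>2 = (\<lambda>x. snd (D (0, x)))"
  have D_summands: "D (a, 0) = (\<delta>\<^sub>1 a, \<delta>\<^sub>2 a)" "D (0, x) = (\<tau>\<^sub>1 x, \<tau>\<^sub>2 x)" for a x
    by (simp_all add: entries)
  have lin: "clinear \<delta>\<^sub>1" "clinear \<delta>\<^sub>2" "clinear \<tau>\<^sub>1" "clinear \<tau>\<^sub>2"
    unfolding entries by (rule clinear_prod_entries[OF \<open>clinear D\<close>])+
  have "D (a, x) = (\<delta>\<^sub>1 a + \<tau>\<^sub>1 x, \<delta>\<^sub>2 a + \<tau>\<^sub>2 x)" for a x
    using clinear_add[OF \<open>clinear D\<close>, of "(a, 0)" "(0, x)"] by (simp add: D_summands)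
  moreover have "\<delta>\<^sub>1 (a * b) = a * \<delta>\<^sub>1 b + \<delta>\<^sub>1 a * b" "\<delta>\<^sub>2 (a * b) = a \<rhd> \<delta>\<^sub>2 b + \<delta>\<^sub>2 a \<lhd> b" for a b
    using leibniz[of "(a, 0)" "(b, 0)"] by (simp_all add: D_summands semidirect_mult_summands)
  moreover have "\<tau>\<^sub>1 (a \<rhd> x) = a * \<tau>\<^sub>1 x" "\<tau>\<^sub>2 (a \<rhd> x) = a \<rhd> \<tau>\<^sub>2 x + \<delta>\<^sub>1 a \<rhd> x + \<delta>\<^sub>2 a * x" for a x
    using leibniz[of "(a, 0)" "(0, x)"]
    by (simp_all add: D_summands semidirect_mult_summands algebra_simps)
  moreover have "\<tau>\<^sub>1 (x \<lhd> a) = \<tau>\<^sub>1 x * a" "\<tau>\<^sub>2 (x \<lhd> a) = \<tau>\<^sub>2 x \<lhd> a + x \<lhd> \<delta>\<^sub>1 a + x * \<delta>\<^sub>2 a" for a x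
    using leibniz[of "(0, x)" "(a, 0)"]
    by (simp_all add: D_summands semidirect_mult_summands algebra_simps)
  moreover have "\<tau>\<^sub>1 (x * y) = 0" "\<tau>\<^sub>2 (x * y) = x \<lhd> \<tau>\<^sub>1 y + \<tau>\<^sub>1 x \<rhd> y + x * \<tau>\<^sub>2 y + \<tau>\<^sub>2 x * y" for x y
    using leibniz[of "(0, x)" "(0, y)"]
    by (simp_all add: D_summands semidirect_mult_summands algebra_simps)
  ultimately have "derivation_components (\<rhd>) (\<lhd>) D \<delta>\<^sub>1 \<delta>\<^sub>2 \<tau>\<^sub>1 \<tau>\<^sub>2"
    unfolding derivation_components_def derivation_def bimodule_hom_def using lin by blast
  then show ?thesis
    by (simp only: entries)
qed

lemma semidirect_commutator:
  "(a, x) \<odot> (a\<^sub>0, x\<^sub>0) - (a\<^sub>0, x\<^sub>0) \<odot> (a, x) =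
    (a * a\<^sub>0 - a\<^sub>0 * a, (a \<rhd> x\<^sub>0 - x\<^sub>0 \<lhd> a) + ((x * x\<^sub>0 - x\<^sub>0 * x) + (x \<lhd> a\<^sub>0 - a\<^sub>0 \<rhd> x)))"
  by (simp add: semidirect_mult_def)

text \<open>
  The values at zero are prescribed because a constant could otherwise be moved between
  \<open>\<delta>\<^sub>1\<close> and \<open>\<tau>\<^sub>1\<close>, or between \<open>\<delta>\<^sub>2\<close> and \<open>\<tau>\<^sub>2\<close>, without changing \<^term>\<open>D\<close>. With them, the entries
  are the restrictions of \<^term>\<open>D\<close> to the summands and can be compared with those of the commutator.
\<close>

lemma inner_iff_components_inner:
  assumes D: "\<And>a x. D (a, x) = (\<delta>\<^sub>1 a + \<tau>\<^sub>1 x, \<delta>\<^sub>2 a + \<tau>\<^sub>2 x)"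
    and zero: "\<delta>\<^sub>1 0 = 0" "\<delta>\<^sub>2 0 = 0" "\<tau>\<^sub>1 0 = 0" "\<tau>\<^sub>2 0 = 0"
  shows "inner_on (\<odot>) D \<longleftrightarrow>
    \<tau>\<^sub>1 = (\<lambda>x. 0) \<and>
    (\<exists>a\<^sub>0 x\<^sub>0. \<delta>\<^sub>1 = (\<lambda>a. a * a\<^sub>0 - a\<^sub>0 * a) \<and> \<delta>\<^sub>2 = (\<lambda>a. a \<rhd> x\<^sub>0 - x\<^sub>0 \<lhd> a) \<and>
      \<tau>\<^sub>2 = (\<lambda>x. (x * x\<^sub>0 - x\<^sub>0 * x) + (x \<lhd> a\<^sub>0 - a\<^sub>0 \<rhd> x)))"
    (is "_ \<longleftrightarrow> ?inner_entries")
proof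
  assume "inner_on (\<odot>) D"
  then obtain a\<^sub>0 x\<^sub>0 where inner: "\<And>p. D p = p \<odot> (a\<^sub>0, x\<^sub>0) - (a\<^sub>0, x\<^sub>0) \<odot> p"
    unfolding inner_on_def by (metis surj_pair)
  have comm: "(\<delta>\<^sub>1 a + \<tau>\<^sub>1 x, \<delta>\<^sub>2 a + \<tau>\<^sub>2 x) =
      (a * a\<^sub>0 - a\<^sub>0 * a, (a \<rhd> x\<^sub>0 - x\<^sub>0 \<lhd> a) + ((x * x\<^sub>0 - x\<^sub>0 * x) + (x \<lhd> a\<^sub>0 - a\<^sub>0 \<rhd> x)))" for a x
    using inner[of "(a, x)"] unfolding D semidirect_commutator .
  have "\<delta>\<^sub>1 a = a * a\<^sub>0 - a\<^sub>0 * a" "\<delta>\<^sub>2 a = a \<rhd> x\<^sub>0 - x\<^sub>0 \<lhd> a" for a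
    using comm[of a 0] by (simp_all add: zero)
  moreover have "\<tau>\<^sub>1 x = 0" "\<tau>\<^sub>2 x = (x * x\<^sub>0 - x\<^sub>0 * x) + (x \<lhd> a\<^sub>0 - a\<^sub>0 \<rhd> x)" for x
    using comm[of 0 x] by (simp_all add: zero)
  ultimately show ?inner_entries
    by blast
next
  assume ?inner_entries
  then obtain a\<^sub>0 x\<^sub>0 where "\<tau>\<^sub>1 = (\<lambda>x. 0)" "\<delta>\<^sub>1 = (\<lambda>a. a * a\<^sub>0 - a\<^sub>0 * a)"
    "\<delta>\<^sub>2 = (\<lambda>a. a \<rhd> x\<^sub>0 - x\<^sub>0 \<lhd> a)" "\<tau>\<^sub>2 = (\<lambda>x. (x * x\<^sub>0 - x\<^sub>0 * x) + (x \<lhd> a\<^sub>0 - a\<^sub>0 \<rhd> x))"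
    by blast
  then have "D p = p \<odot> (a\<^sub>0, x\<^sub>0) - (a\<^sub>0, x\<^sub>0) \<odot> p" for p
    by (cases p) (simp only: D semidirect_commutator add_0_right)
  then show "inner_on (\<odot>) D"
    unfolding inner_on_def by blast
qed

end

theorem theorem3p1:
  fixes lact :: "'a::complex_banach_algebra \<Rightarrow> 'u::complex_banach_algebra \<Rightarrow> 'u"  (infixl "\<rhd>" 70)
    and ract :: "'u \<Rightarrow> 'a \<Rightarrow> 'u"  (infixl "\<lhd>" 70)
    and D :: "'a \<times> 'u \<Rightarrow> 'a \<times> 'u"
  assumes "compatible_banach_bimodule (\<rhd>) (\<lhd>)"
  shows "(derivation_on (semidirect_mult (\<rhd>) (\<lhd>)) D \<longleftrightarrow>
            (\<exists>\<delta>\<^sub>1 \<delta>\<^sub>2 \<tau>\<^sub>1 \<tau>\<^sub>2. derivation_components (\<rhd>) (\<lhd>) D \<delta>\<^sub>1 \<delta>\<^sub>2 \<tau>\<^sub>1 \<tau>\<^sub>2)) \<and>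
         (\<forall>\<delta>\<^sub>1 \<delta>\<^sub>2 \<tau>\<^sub>1 \<tau>\<^sub>2.
            derivation_on (semidirect_mult (\<rhd>) (\<lhd>)) D \<longrightarrow>
            derivation_components (\<rhd>) (\<lhd>) D \<delta>\<^sub>1 \<delta>\<^sub>2 \<tau>\<^sub>1 \<tau>\<^sub>2 \<longrightarrow>
            (inner_on (semidirect_mult (\<rhd>) (\<lhd>)) D \<longleftrightarrow>
              \<tau>\<^sub>1 = (\<lambda>x. 0) \<and>
              (\<exists>a\<^sub>0 x\<^sub>0.
                \<delta>\<^sub>1 = (\<lambda>a. a * a\<^sub>0 - a\<^sub>0 * a) \<and>
                \<delta>\<^sub>2 = (\<lambda>a. a \<rhd> x\<^sub>0 - x\<^sub>0 \<lhd> a) \<and>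
                \<tau>\<^sub>2 = (\<lambda>x. (x * x\<^sub>0 - x\<^sub>0 * x) + (x \<lhd> a\<^sub>0 - a\<^sub>0 \<rhd> x)))))"
proof -
  interpret compatible_banach_bimodule "(\<rhd>)" "(\<lhd>)"
    by fact
  show ?thesis
  proof (intro conjI allI impI)
    show "derivation_on (semidirect_mult (\<rhd>) (\<lhd>)) D \<longleftrightarrow>
        (\<exists>\<delta>\<^sub>1 \<delta>\<^sub>2 \<tau>\<^sub>1 \<tau>\<^sub>2. derivation_components (\<rhd>) (\<lhd>) D \<delta>\<^sub>1 \<delta>\<^sub>2 \<tau>\<^sub>1 \<tau>\<^sub>2)"
      using derivation_components_imp_derivation derivation_imp_derivation_components by blast
  next
    fix \<delta>\<^sub>1 \<delta>\<^sub>2 \<tau>\<^sub>1 \<tau>\<^sub>2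
    assume "derivation_components (\<rhd>) (\<lhd>) D \<delta>\<^sub>1 \<delta>\<^sub>2 \<tau>\<^sub>1 \<tau>\<^sub>2"
    then have "\<And>a x. D (a, x) = (\<delta>\<^sub>1 a + \<tau>\<^sub>1 x, \<delta>\<^sub>2 a + \<tau>\<^sub>2 x)"
      and "clinear \<delta>\<^sub>1" "clinear \<delta>\<^sub>2" "clinear \<tau>\<^sub>1" "clinear \<tau>\<^sub>2"
      by (simp_all add: derivation_components_def derivation_def bimodule_hom_def)
    then show "inner_on (semidirect_mult (\<rhd>) (\<lhd>)) D \<longleftrightarrow>
        \<tau>\<^sub>1 = (\<lambda>x. 0) \<and>
        (\<exists>a\<^sub>0 x\<^sub>0.
          \<delta>\<^sub>1 = (\<lambda>a. a * a\<^sub>0 - a\<^sub>0 * a) \<and>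
          \<delta>\<^sub>2 = (\<lambda>a. a \<rhd> x\<^sub>0 - x\<^sub>0 \<lhd> a) \<and>
          \<tau>\<^sub>2 = (\<lambda>x. (x * x\<^sub>0 - x\<^sub>0 * x) + (x \<lhd> a\<^sub>0 - a\<^sub>0 \<rhd> x)))"
      by (intro inner_iff_components_inner clinear_0)
  qed
qed

end
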